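(* Let $(T,X)$ be a minimal invertible semiflow on a nonempty compact Hausdorff space $X$ such that $T$ is a group or an abelian semigroup. If $x\in P_{aa}(T,X)$, then $x$ is an l.a.p. and distal point of $(T,X)$ in the sense of $T$ with the discrete topology (that is, with syndetic sets understood relative to the discrete topology on $T$).
   Context: $T$ is a topological semigroup with identity $e$. A semiflow $(T,X)$ is a jointly continuous map $T\times X\to X$, $(t,x)\mapsto tx$, with $ex=x$ and $t(sx)=(ts)x$. It is minimal if every orbit $Tx$ is dense in $X$, and invertible if each transition $x\mapsto tx$, $t\in T$, is a bijection of $X$. $x\in P_{aa}(T,X)$ (almost automorphic point) if for every net $\{t_n\}$ in $T$ and net $\{x_n'\}$ in $X$: $t_nx\to y$, $x_n'\to x'$ and $t_nx_n'=y$ for all $n$ imply $x=x'$. A set $A\subseteq T$ is syndetic if there is a compact $K\subseteq T$ with $Kt\cap A\ne\emptyset$ for all $t\in T$; for discrete $T$ this means $K$ is finite. A point $x$ is locally almost periodic (l.a.p.) if for every neighborhood $U$ of $x$ there are a neighborhood $V$ of $x$ and a syndetic $A\subseteq T$ with $AV\subseteq U$. Points $x,y$ are proximal if there is a net $\{t_n\}$ in $T$ with $\lim_n t_nx=\lim_n t_ny$; $x$ is distal if it is proximal only to itself within $\overline{Tx}$. *)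

theory Defs
  imports "HOL-Analysis.Analysis"
begin

text \<open>The class \<open>topological_monoid_mult\<close> provides a topological semigroup with identity \<open>1\<close>
  and jointly continuous multiplication.\<close>

locale semiflow =
  fixes act :: "'t::topological_monoid_mult \<Rightarrow> 'x::topological_space \<Rightarrow> 'x"
  assumes continuous_act: "continuous_on UNIV (\<lambda>(t, x). act t x)"
    and act_one: "act 1 x = x"
    and act_act: "act t (act s x) = act (t * s) x"

definition orb :: "('t \<Rightarrow> 'x \<Rightarrow> 'x) \<Rightarrow> 'x \<Rightarrow> 'x set"
  where "orb act x = range (\<lambda>t. act t x)"

definition minimal_flow :: "('t \<Rightarrow> 'x::topological_space \<Rightarrow> 'x) \<Rightarrow> bool"
  where "minimal_flow act \<longleftrightarrow> (\<forall>x. closure (orb act x) = UNIV)"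

definition invertible_flow :: "('t \<Rightarrow> 'x \<Rightarrow> 'x) \<Rightarrow> bool"
  where "invertible_flow act \<longleftrightarrow> (\<forall>t. bij (act t))"

text \<open>\<open>(a, b) \<in> r\<close> means that \<open>b\<close> is beyond \<open>a\<close>. A net indexed by \<open>(D, r)\<close> converges iff it tends to its
  limit along the filter of its tails.\<close>

definition directed_on :: "'i set \<Rightarrow> 'i rel \<Rightarrow> bool"
  where "directed_on D r \<longleftrightarrow> D \<noteq> {} \<and> preorder_on D r \<and>
    (\<forall>a\<in>D. \<forall>b\<in>D. \<exists>c\<in>D. (a, c) \<in> r \<and> (b, c) \<in> r)"

definition tails :: "'i set \<Rightarrow> 'i rel \<Rightarrow> 'i filter"
  where "tails D r = (INF a\<in>D. principal (r `` {a}))"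

text \<open>A definition cannot quantify over all index types. In the next two definitions nets are indexed
  by directed subsets of \<open>'x set \<times> 'x set\<close>; the lemmas \<open>aa_points_net\<close> and \<open>proximal_net\<close>
  below show that this covers nets over arbitrary directed sets.\<close>

definition aa_points :: "('t \<Rightarrow> 'x::topological_space \<Rightarrow> 'x) \<Rightarrow> 'x set"
  where "aa_points act = {x. \<forall>(D :: ('x set \<times> 'x set) set) r (t :: 'x set \<times> 'x set \<Rightarrow> 't) x' y z.
    directed_on D r \<longrightarrow>
    ((\<lambda>n. act (t n) x) \<longlongrightarrow> y) (tails D r) \<longrightarrow>
    (x' \<longlongrightarrow> z) (tails D r) \<longrightarrow>
    (\<forall>n\<in>D. act (t n) (x' n) = y) \<longrightarrow> x = z}"

definition proximal :: "('t \<Rightarrow> 'x::topological_space \<Rightarrow> 'x) \<Rightarrow> 'x \<Rightarrow> 'x \<Rightarrow> bool"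
  where "proximal act x y \<longleftrightarrow>
    (\<exists>(D :: ('x set \<times> 'x set) set) r (t :: 'x set \<times> 'x set \<Rightarrow> 't) z. directed_on D r \<and>
      ((\<lambda>n. act (t n) x) \<longlongrightarrow> z) (tails D r) \<and>
      ((\<lambda>n. act (t n) y) \<longlongrightarrow> z) (tails D r))"

definition distal_point :: "('t \<Rightarrow> 'x::topological_space \<Rightarrow> 'x) \<Rightarrow> 'x \<Rightarrow> bool"
  where "distal_point act x \<longleftrightarrow> (\<forall>y \<in> closure (orb act x). proximal act x y \<longrightarrow> y = x)"

text \<open>The topology on the acting semigroup is an explicit parameter, so that it can be replaced
  by the discrete one.\<close>

definition syndetic :: "'t::times topology \<Rightarrow> 't set \<Rightarrow> bool"
  where "syndetic \<tau> A \<longleftrightarrow> (\<exists>K. compactin \<tau> K \<and> (\<forall>t. (\<lambda>k. k * t) ` K \<inter> A \<noteq> {}))"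

definition lap_point :: "'t::times topology \<Rightarrow> ('t \<Rightarrow> 'x::topological_space \<Rightarrow> 'x) \<Rightarrow> 'x \<Rightarrow> bool"
  where "lap_point \<tau> act x \<longleftrightarrow> (\<forall>U. x \<in> interior U \<longrightarrow>
    (\<exists>V A. x \<in> interior V \<and> syndetic \<tau> A \<and> (\<lambda>(t, v). act t v) ` (A \<times> V) \<subseteq> U))"

lemma syndetic_discrete:
  "syndetic (discrete_topology UNIV) A \<longleftrightarrow> (\<exists>K. finite K \<and> (\<forall>t. (\<lambda>k. k * t) ` K \<inter> A \<noteq> {}))"
  by (simp add: syndetic_def compactin_discrete_topology)

lemma eventually_tails:
  assumes "directed_on D r"
  shows "eventually P (tails D r) \<longleftrightarrow> (\<exists>a\<in>D. \<forall>b. (a, b) \<in> r \<longrightarrow> P b)"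
  unfolding tails_def
proof (subst eventually_INF_base)
  show "D \<noteq> {}" using assms by (simp add: directed_on_def)
next
  fix a b assume "a \<in> D" "b \<in> D"
  then obtain c where "c \<in> D" "(a, c) \<in> r" "(b, c) \<in> r"
    using assms unfolding directed_on_def by blast
  moreover have "trans r" using assms by (simp add: directed_on_def preorder_on_def)
  ultimately show "\<exists>c\<in>D. principal (r `` {c}) \<le> inf (principal (r `` {a})) (principal (r `` {b}))"
    by (intro bexI[of _ c]) (auto dest: transD)
qed (auto simp: eventually_principal)

lemma tails_subnet:
  fixes D :: "'i set" and f g :: "'i \<Rightarrow> 'x::topological_space"
  assumes dir: "directed_on D r" and f: "(f \<longlongrightarrow> a) (tails D r)" and g: "(g \<longlongrightarrow> b) (tails D r)"
  shows "\<exists>(D' :: ('x set \<times> 'x set) set) r' h. directed_on D' r' \<and> h ` D' \<subseteq> D \<and>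
    ((\<lambda>n. f (h n)) \<longlongrightarrow> a) (tails D' r') \<and> ((\<lambda>n. g (h n)) \<longlongrightarrow> b) (tails D' r')"
proof -
  define D' where "D' = {(U, V). open U \<and> a \<in> U \<and> open V \<and> b \<in> V}"
  define r' where "r' = {(p, q). p \<in> D' \<and> q \<in> D' \<and> fst q \<subseteq> fst p \<and> snd q \<subseteq> snd p}"
  have dir': "directed_on D' r'"
    unfolding directed_on_def
  proof (intro conjI ballI)
    show "D' \<noteq> {}" by (auto simp: D'_def)
    show "preorder_on D' r'"
      by (auto simp: preorder_on_def r'_def refl_on_def trans_def)
  next
    fix p q assume "p \<in> D'" "q \<in> D'"
    then show "\<exists>c\<in>D'. (p, c) \<in> r' \<and> (q, c) \<in> r'"
      by (intro bexI[of _ "(fst p \<inter> fst q, snd p \<inter> snd q)"]) (auto simp: r'_def D'_def)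
  qed
  have "\<exists>d\<in>D. f d \<in> fst p \<and> g d \<in> snd p" if "p \<in> D'" for p
  proof -
    have "eventually (\<lambda>n. f n \<in> fst p \<and> g n \<in> snd p) (tails D r)"
      using that topological_tendstoD[OF f, of "fst p"] topological_tendstoD[OF g, of "snd p"]
      by (auto simp: D'_def intro: eventually_conj)
    then obtain d where "d \<in> D" "\<forall>n. (d, n) \<in> r \<longrightarrow> f n \<in> fst p \<and> g n \<in> snd p"
      unfolding eventually_tails[OF dir] by (elim bexE)
    moreover have "(d, d) \<in> r"
      using dir \<open>d \<in> D\<close> by (simp add: directed_on_def preorder_on_def refl_on_def)
    ultimately show ?thesis by blast
  qed
  then obtain h where h: "\<And>p. p \<in> D' \<Longrightarrow> h p \<in> D \<and> f (h p) \<in> fst p \<and> g (h p) \<in> snd p"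
    by metis
  have "((\<lambda>n. f (h n)) \<longlongrightarrow> a) (tails D' r')"
  proof (rule topological_tendstoI)
    fix S assume "open S" "a \<in> S"
    then have "(S, UNIV) \<in> D'" by (simp add: D'_def)
    then show "eventually (\<lambda>n. f (h n) \<in> S) (tails D' r')"
      using h unfolding eventually_tails[OF dir'] by (intro bexI[of _ "(S, UNIV)"]) (auto simp: r'_def)
  qed
  moreover have "((\<lambda>n. g (h n)) \<longlongrightarrow> b) (tails D' r')"
  proof (rule topological_tendstoI)
    fix S assume "open S" "b \<in> S"
    then have "(UNIV, S) \<in> D'" by (simp add: D'_def)
    then show "eventually (\<lambda>n. g (h n) \<in> S) (tails D' r')"
      using h unfolding eventually_tails[OF dir'] by (intro bexI[of _ "(UNIV, S)"]) (auto simp: r'_def)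
  qed
  ultimately show ?thesis using dir' h by blast
qed

lemma aa_points_net:
  fixes D :: "'i set" and t :: "'i \<Rightarrow> 't" and act :: "'t \<Rightarrow> 'x::topological_space \<Rightarrow> 'x"
  assumes x: "x \<in> aa_points act" and dir: "directed_on D r"
    and "((\<lambda>n. act (t n) x) \<longlongrightarrow> y) (tails D r)" "(x' \<longlongrightarrow> z) (tails D r)"
    and eq: "\<forall>n\<in>D. act (t n) (x' n) = y"
  shows "x = z"
proof -
  obtain D' :: "('x set \<times> 'x set) set" and r' h where *: "directed_on D' r'" "h ` D' \<subseteq> D"
    "((\<lambda>n. act (t (h n)) x) \<longlongrightarrow> y) (tails D' r')" "((\<lambda>n. x' (h n)) \<longlongrightarrow> z) (tails D' r')"
    using tails_subnet[OF assms(2-4)] by blast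
  have "\<forall>n\<in>D'. act (t (h n)) (x' (h n)) = y" using *(2) eq by blast
  with *(1,3,4) show ?thesis
    using x[unfolded aa_points_def mem_Collect_eq, rule_format, of D' r' "\<lambda>n. t (h n)" y "\<lambda>n. x' (h n)" z]
    by simp
qed

lemma proximal_net:
  fixes D :: "'i set" and t :: "'i \<Rightarrow> 't" and act :: "'t \<Rightarrow> 'x::topological_space \<Rightarrow> 'x"
  assumes "directed_on D r" "((\<lambda>n. act (t n) x) \<longlongrightarrow> z) (tails D r)"
    "((\<lambda>n. act (t n) y) \<longlongrightarrow> z) (tails D r)"
  shows "proximal act x y"
proof -
  obtain D' :: "('x set \<times> 'x set) set" and r' h where *: "directed_on D' r'" "h ` D' \<subseteq> D"
    "((\<lambda>n. act (t (h n)) x) \<longlongrightarrow> z) (tails D' r')"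
    "((\<lambda>n. act (t (h n)) y) \<longlongrightarrow> z) (tails D' r')"
    using tails_subnet[OF assms] by blast
  then show ?thesis
    unfolding proximal_def
    by (intro exI[of _ D'] exI[of _ r'] exI[of _ "\<lambda>n. t (h n)"] exI[of _ z]) simp
qed

end

theory Submission
  imports Defs
begin

text \<open>Write \<open>N(W) = {t. tx \<in> W}\<close>. Choosing returns \<open>\<sigma>\<^sub>k\<close>, \<open>\<tau>\<^sub>k\<close> of \<open>x\<close> into rapidly shrinking neighbourhoods
  and testing almost automorphy on the products \<open>\<tau>\<^sub>0 \<dots> \<tau>\<^sub>k\<^sub>-\<^sub>1 \<sigma>\<^sub>k\<close> (an idea of Veech) shows that
  \<open>s\<inverse>t x\<close> is close to \<open>x\<close> for \<open>s\<close>, \<open>t\<close> in a suitable \<open>N(W)\<close>; by density of the orbit, \<open>s\<inverse>W\<close> is close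
  to \<open>x\<close> for \<open>s \<in> N(W)\<close>. Distality follows at once: if \<open>t\<^sub>nx\<close> and \<open>t\<^sub>ny\<close> have a common limit, which by
  minimality may be taken to be \<open>x\<close>, then \<open>y \<in> t\<^sub>n\<inverse>W\<close> is close to \<open>x\<close>. For local almost periodicity one
  replaces \<open>s\<inverse>\<close> by \<open>s\<close>: if \<open>s'\<close> nearly inverts \<open>s\<close> at \<open>x\<close>, then \<open>s'x \<in> s\<inverse>W\<close> is near \<open>x\<close>, so that
  \<open>s'\<inverse>tx\<close>, which is nearly \<open>stx\<close>, is near \<open>x\<close> as well. Hence \<open>sW\<close> is close to \<open>x\<close> for all \<open>s\<close> in the
  syndetic set \<open>N(W)\<close>.\<close>

section \<open>Filters and compactness\<close>

text \<open>The filter form of passing to a convergent subnet: refine \<open>F\<close> by the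
  preimages of neighbourhoods of a cluster point of \<open>f\<close>.\<close>

lemma compact_UNIV_tendsto_subfilter:
  fixes f :: "'i \<Rightarrow> 'x::topological_space"
  assumes "compact (UNIV :: 'x set)" and "F \<noteq> bot"
  obtains G z where "G \<le> F" "G \<noteq> bot" "(f \<longlongrightarrow> z) G"
proof -
  have "filtermap f F \<noteq> bot" using assms(2) by (simp add: filtermap_bot_iff)
  then obtain z where z: "inf (nhds z) (filtermap f F) \<noteq> bot"
    using assms(1) unfolding compact_filter by auto
  define G where "G = inf F (filtercomap f (nhds z))"
  have "G \<noteq> bot"
  proof
    assume "G = bot"
    then have "eventually (\<lambda>_. False) G" by simp
    then obtain P Q where P: "eventually P F" and Q: "eventually Q (nhds z)"
      and PQ: "\<And>i. P i \<Longrightarrow> \<not> Q (f i)"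
      unfolding G_def eventually_inf eventually_filtercomap by blast
    have "eventually (\<lambda>w. \<not> Q w) (filtermap f F)"
      unfolding eventually_filtermap by (rule eventually_mono[OF P]) (use PQ in blast)
    then have "eventually (\<lambda>_. False) (inf (nhds z) (filtermap f F))"
      unfolding eventually_inf using Q by blast
    then show False using z by (simp add: trivial_limit_def)
  qed
  moreover have "(f \<longlongrightarrow> z) G"
    unfolding G_def by (rule filterlim_mono[OF filterlim_filtercomap order_refl inf_le2])
  moreover have "G \<le> F" by (simp add: G_def)
  ultimately show ?thesis using that by blast
qed

lemma compact_UNIV_cluster_point:
  fixes a :: "nat \<Rightarrow> 'x::topological_space"
  assumes "compact (UNIV :: 'x set)"
  obtains y where "\<And>S m. open S \<Longrightarrow> y \<in> S \<Longrightarrow> \<exists>j\<ge>m. a j \<in> S"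
proof -
  obtain G y where G: "G \<le> sequentially" "G \<noteq> bot" "(a \<longlongrightarrow> y) G"
    using compact_UNIV_tendsto_subfilter[OF assms trivial_limit_sequentially] by metis
  have "\<exists>j\<ge>m. a j \<in> S" if "open S" "y \<in> S" for S m
  proof -
    have "eventually (\<lambda>j. a j \<in> S) G" by (rule topological_tendstoD[OF G(3) that])
    moreover have "eventually (\<lambda>j. j \<ge> m) G"
      by (rule filter_leD[OF G(1) eventually_ge_at_top])
    ultimately have "eventually (\<lambda>j. j \<ge> m \<and> a j \<in> S) G" by (simp add: eventually_conj_iff)
    then show ?thesis using eventually_happens G(2) by blast
  qed
  then show ?thesis using that by blast
qed

lemma compact_t2_regular:
  fixes x :: "'x::t2_space"
  assumes "compact (UNIV :: 'x set)" and "open U" "x \<in> U"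
  obtains V where "open V" "x \<in> V" "closure V \<subseteq> U"
proof -
  have "Hausdorff_space (euclidean :: 'x topology)"
    by (auto simp: Hausdorff_space_def disjnt_def separation_t2)
  then have "regular_space (euclidean :: 'x topology)"
    using assms(1) by (intro compact_Hausdorff_imp_regular_space) (auto simp: compact_space_def)
  then have "\<exists>V. open V \<and> x \<in> V \<and> disjnt (- U) (closure V)"
    using assms(2,3) by (simp add: regular_space euclidean_closure_of closed_open)
  then show ?thesis using that by (auto simp: disjnt_def)
qed

lemma eq_if_in_closure_nhds:
  fixes x y :: "'x::t2_space"
  assumes "\<And>U. open U \<Longrightarrow> x \<in> U \<Longrightarrow> y \<in> closure U"
  shows "y = x"
proof (rule ccontr)
  assume "y \<noteq> x"
  then obtain U V where UV: "open U" "open V" "x \<in> U" "y \<in> V" "U \<inter> V = {}"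
    using separation_t2 by metis
  then have "closure U \<inter> V = {}" by (metis inf_commute open_Int_closure_eq_empty)
  then show False using assms[OF UV(1,3)] UV(4) by blast
qed

lemma tails_neq_bot:
  assumes "directed_on D r"
  shows "tails D r \<noteq> bot"
proof
  assume "tails D r = bot"
  then have "eventually (\<lambda>_. False) (tails D r)" by simp
  then obtain a where "a \<in> D" "\<forall>b. (a, b) \<notin> r"
    unfolding eventually_tails[OF assms] by blast
  then show False using assms by (auto simp: directed_on_def preorder_on_def refl_on_def)
qed

text \<open>Nets become filters: pairs of an eventual property of \<open>F\<close> and an index
  satisfying it, ordered by implication of the properties, form a directed set along which maps
  converge as along \<open>F\<close>.\<close>

lemma aa_points_filter:
  fixes F :: "'i filter" and act :: "'t \<Rightarrow> 'x::topological_space \<Rightarrow> 'x"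
  assumes "x \<in> aa_points act" and "F \<noteq> bot"
    and y: "((\<lambda>i. act (t i) x) \<longlongrightarrow> y) F" and z: "(x' \<longlongrightarrow> z) F"
    and eq: "\<And>i. act (t i) (x' i) = y"
  shows "x = z"
proof -
  define D where "D = {(i, P). eventually P F \<and> P i}"
  define r where "r = {(p, q). p \<in> D \<and> q \<in> D \<and> (\<forall>j. snd q j \<longrightarrow> snd p j)}"
  have mem: "\<exists>i. (i, P) \<in> D" if "eventually P F" for P
    using eventually_happens[OF that] assms(2) that by (auto simp: D_def)
  have dir: "directed_on D r"
    unfolding directed_on_def
  proof (intro conjI ballI)
    show "D \<noteq> {}" using mem[of "\<lambda>_. True"] by auto
    show "preorder_on D r"
      by (auto simp: preorder_on_def r_def refl_on_def trans_def)
  next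
    fix p q assume pq: "p \<in> D" "q \<in> D"
    then have "eventually (\<lambda>j. snd p j \<and> snd q j) F" by (auto simp: D_def eventually_conj_iff)
    then obtain i where "(i, \<lambda>j. snd p j \<and> snd q j) \<in> D" using mem by blast
    then show "\<exists>c\<in>D. (p, c) \<in> r \<and> (q, c) \<in> r"
      using pq by (intro bexI) (auto simp: r_def)
  qed
  have lim: "((\<lambda>p. h (fst p)) \<longlongrightarrow> l) (tails D r)" if "(h \<longlongrightarrow> l) F" for h :: "'i \<Rightarrow> 'x" and l
  proof (rule topological_tendstoI)
    fix S assume "open S" "l \<in> S"
    then have "eventually (\<lambda>i. h i \<in> S) F" by (rule topological_tendstoD[OF that])
    then obtain i where "(i, \<lambda>i. h i \<in> S) \<in> D" using mem by blast
    then show "eventually (\<lambda>p. h (fst p) \<in> S) (tails D r)"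
      unfolding eventually_tails[OF dir] by (rule bexI[rotated]) (auto simp: r_def D_def)
  qed
  show ?thesis
    by (rule aa_points_net[OF assms(1) dir lim[OF y] lim[OF z]]) (use eq in simp)
qed

section \<open>Returns of an almost automorphic point\<close>

locale compact_minimal_invertible_semiflow = semiflow act
  for act :: "'t::topological_monoid_mult \<Rightarrow> 'x::t2_space \<Rightarrow> 'x" +
  assumes compact_space: "compact (UNIV :: 'x set)"
    and minimal: "minimal_flow act"
    and invertible: "invertible_flow act"
begin

abbreviation iact :: "'t \<Rightarrow> 'x \<Rightarrow> 'x"
  where "iact t \<equiv> inv (act t)"

lemma iact_act [simp]: "iact t (act t w) = w"
  using invertible by (simp add: invertible_flow_def bij_def)

lemma act_iact [simp]: "act t (iact t w) = w"
  using invertible by (simp add: invertible_flow_def bij_def surj_f_inv_f)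

lemma iact_eq_iff: "iact t w = v \<longleftrightarrow> w = act t v"
  by auto

lemma iact_mult: "iact (s * t) w = iact t (iact s w)"
  by (simp add: iact_eq_iff flip: act_act)

lemma continuous_act_right: "continuous_on UNIV (act t)"
  using continuous_on_compose2[OF continuous_act, of UNIV "\<lambda>w. (t, w)"]
  by (simp add: continuous_on_Pair)

lemma continuous_iact: "continuous_on UNIV (iact t)"
proof -
  have "continuous_on (range (act t)) (iact t)"
    by (rule continuous_on_inv[OF continuous_act_right compact_space]) simp
  then show ?thesis using invertible by (simp add: invertible_flow_def bij_def)
qed

lemma open_vimage_act: "open S \<Longrightarrow> open (act t -` S)"
  by (rule open_vimage[OF _ continuous_act_right])

lemma open_vimage_iact: "open S \<Longrightarrow> open (iact t -` S)"
  by (rule open_vimage[OF _ continuous_iact])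

lemma orbit_meets:
  assumes "open S" "S \<noteq> {}"
  obtains t where "act t w \<in> S"
proof -
  have "S \<inter> closure (orb act w) \<noteq> {}"
    using minimal assms(2) by (simp add: minimal_flow_def)
  then have "S \<inter> orb act w \<noteq> {}" using open_Int_closure_eq_empty[OF assms(1)] by blast
  then show ?thesis using that by (auto simp: orb_def)
qed

text \<open>The points of \<open>W\<close> that \<open>f\<close> sends outside
  \<open>closure U\<close> form an open set; if nonempty, it would meet the dense orbit.\<close>

lemma image_subset_closure_if_orbit:
  assumes "continuous_on UNIV f" "open W" and *: "\<And>t. act t w \<in> W \<Longrightarrow> f (act t w) \<in> closure U"
  shows "f ` W \<subseteq> closure U"
proof (rule ccontr)
  assume "\<not> f ` W \<subseteq> closure U"
  then have "W \<inter> f -` (- closure U) \<noteq> {}" by auto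
  moreover have "open (W \<inter> f -` (- closure U))"
    using assms(1,2) by (intro open_Int open_vimage) auto
  ultimately obtain t where "act t w \<in> W \<inter> f -` (- closure U)" using orbit_meets by metis
  then show False using * by auto
qed

text \<open>By compactness finitely many preimages of \<open>W\<close> cover the space; one of them
  contains \<open>act t x\<close>, whatever \<open>t\<close> is.\<close>

lemma syndetic_returns:
  assumes "open W" "W \<noteq> {}"
  shows "syndetic (discrete_topology UNIV) {t. act t x \<in> W}"
proof -
  have "w \<in> (\<Union>k. act k -` W)" for w
    by (rule orbit_meets[OF assms, of w]) auto
  then have cover: "UNIV \<subseteq> (\<Union>k. act k -` W)" by blast
  obtain K where K: "finite K" "UNIV \<subseteq> (\<Union>k\<in>K. act k -` W)"
    by (rule compactE_image[OF compact_space open_vimage_act[OF assms(1)] cover]) (rule that)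
  have "(\<lambda>k. k * t) ` K \<inter> {t. act t x \<in> W} \<noteq> {}" for t
  proof -
    obtain k where "k \<in> K" "act k (act t x) \<in> W" using K(2) by blast
    then show ?thesis by (auto simp: act_act)
  qed
  then show ?thesis using K(1) by (auto simp: syndetic_discrete)
qed

text \<open>Otherwise \<open>act t x\<close> tends to \<open>y\<close> along some \<open>t\<close>
  with \<open>iact t y\<close> outside \<open>U\<close>; by compactness \<open>iact t y\<close>
  converges along a subnet, and almost automorphy makes the limit \<open>x\<close>.\<close>

lemma aa_return:
  assumes "x \<in> aa_points act" "open U" "x \<in> U"
  obtains W where "open W" "y \<in> W" "\<And>s. act s x \<in> W \<Longrightarrow> iact s y \<in> U"
proof -
  define F where "F = inf (filtercomap (\<lambda>t. act t x) (nhds y)) (principal {t. iact t y \<notin> U})"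
  have "F = bot"
  proof (rule ccontr)
    assume "F \<noteq> bot"
    then obtain G z where G: "G \<le> F" "G \<noteq> bot" "((\<lambda>t. iact t y) \<longlongrightarrow> z) G"
      using compact_UNIV_tendsto_subfilter[OF compact_space] by metis
    have "G \<le> filtercomap (\<lambda>t. act t x) (nhds y)" using G(1) by (simp add: F_def)
    then have "((\<lambda>t. act t x) \<longlongrightarrow> y) G"
      by (rule filterlim_mono[OF filterlim_filtercomap order_refl])
    then have "x = z" using aa_points_filter[OF assms(1) G(2) _ G(3)] by simp
    then have "eventually (\<lambda>t. iact t y \<in> U) G"
      using topological_tendstoD[OF G(3)] assms(2,3) by blast
    moreover have "eventually (\<lambda>t. iact t y \<notin> U) G"
      by (intro filter_leD[OF G(1)]) (simp add: F_def eventually_inf_principal)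
    ultimately have "eventually (\<lambda>t. False) G" by eventually_elim simp
    then show False using G(2) by (simp add: trivial_limit_def)
  qed
  then have "eventually (\<lambda>_. False) F" by simp
  then have "eventually (\<lambda>t. iact t y \<in> U) (filtercomap (\<lambda>t. act t x) (nhds y))"
    by (simp add: F_def eventually_inf_principal)
  then obtain Q where "eventually Q (nhds y)" "\<And>t. Q (act t x) \<Longrightarrow> iact t y \<in> U"
    unfolding eventually_filtercomap by blast
  then show ?thesis using that unfolding eventually_nhds by metis
qed

text \<open>Otherwise there are \<open>\<sigma>\<^sub>k\<close>, \<open>\<tau>\<^sub>k\<close> with \<open>\<sigma>\<^sub>kx, \<tau>\<^sub>kx \<in> P\<^sub>k\<close> and \<open>\<sigma>\<^sub>k\<inverse>\<tau>\<^sub>kx \<in> O\<close>, the complement of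
  \<open>closure U\<close>. For
  \<open>\<alpha>\<^sub>j = \<tau>\<^sub>0 \<dots> \<tau>\<^sub>j\<^sub>-\<^sub>1\<sigma>\<^sub>j\<close>, shrinking \<open>P\<^sub>k\<close> keeps \<open>\<alpha>\<^sub>i\<inverse>\<alpha>\<^sub>jx = \<sigma>\<^sub>i\<inverse>\<tau>\<^sub>i\<tau>\<^sub>i\<^sub>+\<^sub>1 \<dots> \<tau>\<^sub>j\<^sub>-\<^sub>1\<sigma>\<^sub>jx\<close> in the open set \<open>O\<close> for all \<open>j > i\<close>,
  so \<open>\<alpha>\<^sub>i\<inverse>y\<close> avoids \<open>U\<close> for every cluster point \<open>y\<close> of \<open>\<alpha>\<^sub>jx\<close>, against almost automorphy.\<close>

lemma aa_quotient_of_returns: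
  assumes aa: "x \<in> aa_points act" and U: "open U" "x \<in> U"
  obtains W where "open W" "x \<in> W"
    "\<And>s t. act s x \<in> W \<Longrightarrow> act t x \<in> W \<Longrightarrow> iact s (act t x) \<in> closure U"
proof (rule ccontr)
  note witness = that
  assume "\<not> thesis"
  define O' where "O' = - closure U"
  have O': "open O'" by (simp add: O'_def open_Compl)
  have ex: "\<exists>s t. act s x \<in> W \<and> act t x \<in> W \<and> iact s (act t x) \<in> O'"
    if "open W" "x \<in> W" for W
  proof (rule ccontr)
    assume "\<not> ?thesis"
    then have "iact s (act t x) \<in> closure U" if "act s x \<in> W" "act t x \<in> W" for s t
      using that by (auto simp: O'_def)
    with \<open>\<not> thesis\<close> show False using witness[OF \<open>open W\<close> \<open>x \<in> W\<close>] by blast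
  qed
  \<comment> \<open>\<open>p\<close> accumulates the earlier \<open>t\<close>, from an arbitrary
    initial value that cancels in \<open>iact (\<alpha> i) (act (\<alpha> j) x)\<close>.\<close>
  define inva where "inva = (\<lambda>(p::'t, P, s, t). open P \<and> x \<in> P \<and>
    act s x \<in> P \<and> act t x \<in> P \<and> iact s (act t x) \<in> O')"
  define next_st where "next_st = (\<lambda>(p, P, s, t) (p', P', _::'t, _::'t).
    p' = p * t \<and> P' = act t -` (P \<inter> iact s -` O'))"
  have "\<exists>f. \<forall>n. inva (f n) \<and> next_st (f n) (f (Suc n))"
  proof (rule dependent_nat_choice)
    show "\<exists>q. inva q" using ex[of UNIV] by (auto simp: inva_def)
  next
    fix q :: "'t \<times> 'x set \<times> 't \<times> 't"
    assume q: "inva q"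
    obtain p P s t where [simp]: "q = (p, P, s, t)" by (cases q)
    let ?P = "act t -` (P \<inter> iact s -` O')"
    have "open ?P" "x \<in> ?P"
      using q O' by (auto simp: inva_def intro!: open_vimage_act open_vimage_iact open_Int
          simp del: vimage_Int)
    with ex[OF this] show "\<exists>q'. inva q' \<and> next_st q q'"
      by (auto simp: inva_def next_st_def)
  qed
  then obtain f where f: "\<And>n. inva (f n)" "\<And>n. next_st (f n) (f (Suc n))" by blast
  define p where "p n = fst (f n)" for n
  define P where "P n = fst (snd (f n))" for n
  define \<sigma> where "\<sigma> n = fst (snd (snd (f n)))" for n
  define \<tau> where "\<tau> n = snd (snd (snd (f n)))" for n
  have \<sigma>: "act (\<sigma> n) x \<in> P n" for n
    using f(1)[of n] by (simp add: inva_def P_def \<sigma>_def split: prod.splits)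
  have p: "p (Suc n) = p n * \<tau> n" for n
    using f(2)[of n] by (simp add: next_st_def p_def \<tau>_def split: prod.splits)
  have P: "P (Suc n) = act (\<tau> n) -` (P n \<inter> iact (\<sigma> n) -` O')" for n
    using f(2)[of n] by (simp add: next_st_def P_def \<tau>_def \<sigma>_def split: prod.splits)
  define \<alpha> where "\<alpha> n = p n * \<sigma> n" for n
  \<comment> \<open>Allowing every \<open>w\<close> in \<open>P j\<close>, not only
    \<open>act (\<sigma> j) x\<close>, lets the induction peel off one \<tau> at a time.\<close>
  have P_O': "iact (\<alpha> i) (act (p j) w) \<in> O'" if "i < j" "w \<in> P j" for i j w
    using that
  proof (induction j arbitrary: w)
    case (Suc j)
    have w: "act (\<tau> j) w \<in> P j" "iact (\<sigma> j) (act (\<tau> j) w) \<in> O'" using Suc.prems(2) P by auto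
    show ?case
    proof (cases "i = j")
      case True
      have "act (p (Suc j)) w = act (p j) (act (\<tau> j) w)" by (simp add: p act_act)
      then show ?thesis using w(2) True by (simp add: \<alpha>_def iact_mult)
    next
      case False
      then show ?thesis using Suc.IH[OF _ w(1)] Suc.prems(1) by (simp add: p act_act)
    qed
  qed simp
  have \<alpha>_O': "iact (\<alpha> i) (act (\<alpha> j) x) \<in> O'" if "i < j" for i j
    using P_O'[OF that \<sigma>] by (simp add: \<alpha>_def act_act)
  obtain y where y: "\<And>S m. open S \<Longrightarrow> y \<in> S \<Longrightarrow> \<exists>j\<ge>m. act (\<alpha> j) x \<in> S"
    by (rule compact_UNIV_cluster_point[OF compact_space, of "\<lambda>j. act (\<alpha> j) x"]) (rule that)
  obtain W where W: "open W" "y \<in> W" "\<And>s. act s x \<in> W \<Longrightarrow> iact s y \<in> U"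
    using aa_return[OF aa U] by blast
  obtain i where "act (\<alpha> i) x \<in> W" using y[OF W(1,2)] by blast
  then have "y \<in> iact (\<alpha> i) -` U" using W(3) by simp
  then obtain j where "j \<ge> Suc i" "act (\<alpha> j) x \<in> iact (\<alpha> i) -` U"
    using y[OF open_vimage_iact[OF U(1)]] by blast
  then show False using \<alpha>_O'[of i j] closure_subset[of U] by (auto simp: O'_def)
qed

text \<open>For fixed \<open>s\<close>, density of the orbit extends the quotient estimate from
  returns of \<open>x\<close> to all of \<open>W\<close>; regularity absorbs the closure.\<close>

lemma aa_inverse_returns:
  assumes "x \<in> aa_points act" and U: "open U" "x \<in> U"
  obtains W where "open W" "x \<in> W" "\<And>s. act s x \<in> W \<Longrightarrow> iact s ` W \<subseteq> U"
proof -
  obtain V where V: "open V" "x \<in> V" "closure V \<subseteq> U"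
    using compact_t2_regular[OF compact_space U] by blast
  obtain W where W: "open W" "x \<in> W"
    "\<And>s t. act s x \<in> W \<Longrightarrow> act t x \<in> W \<Longrightarrow> iact s (act t x) \<in> closure V"
    using aa_quotient_of_returns[OF assms(1) V(1,2)] by blast
  have "iact s ` W \<subseteq> U" if "act s x \<in> W" for s
    using image_subset_closure_if_orbit[OF continuous_iact W(1) W(3)[OF that]] V(3) by blast
  then show ?thesis using that W(1,2) by blast
qed

lemma aa_forward_returns:
  assumes aa: "x \<in> aa_points act" and U: "open U" "x \<in> U"
    and T: "(\<forall>t::'t. \<exists>s. s * t = 1 \<and> t * s = 1) \<or> (\<forall>s t::'t. s * t = t * s)"
  obtains W where "open W" "x \<in> W" "\<And>s. act s x \<in> W \<Longrightarrow> act s ` W \<subseteq> closure U"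
proof -
  obtain W\<^sub>1 where W\<^sub>1: "open W\<^sub>1" "x \<in> W\<^sub>1" "\<And>s. act s x \<in> W\<^sub>1 \<Longrightarrow> iact s ` W\<^sub>1 \<subseteq> U"
    using aa_inverse_returns[OF aa U] by blast
  \<comment> \<open>\<open>W\<^sub>0\<close> will make an exact or approximate inverse of
    \<open>s\<close> a return to \<open>W\<^sub>1\<close>, so that its own inverse maps
    \<open>W\<^sub>1\<close> into \<open>U\<close>.\<close>
  obtain W\<^sub>0 where W\<^sub>0: "open W\<^sub>0" "x \<in> W\<^sub>0" "\<And>s. act s x \<in> W\<^sub>0 \<Longrightarrow> iact s ` W\<^sub>0 \<subseteq> W\<^sub>1"
    using aa_inverse_returns[OF aa W\<^sub>1(1,2)] by blast
  define W where "W = W\<^sub>0 \<inter> W\<^sub>1"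
  have W: "open W" "x \<in> W" using W\<^sub>0(1,2) W\<^sub>1(1,2) by (auto simp: W_def)
  have U_closure: "act s (act t x) \<in> closure U" if s: "act s x \<in> W" and t: "act t x \<in> W" for s t
    using T
  proof
    assume "\<forall>t::'t. \<exists>s. s * t = 1 \<and> t * s = 1"
    then obtain s' where s': "s * s' = 1" "s' * s = 1" by blast
    have inv: "iact s = act s'" "iact s' = act s" using s' by (auto simp: fun_eq_iff iact_eq_iff act_act act_one)
    have "act s' x \<in> W\<^sub>1" using W\<^sub>0(3)[of s] s W\<^sub>0(2) inv by (auto simp: W_def)
    then have "iact s' (act t x) \<in> U" using W\<^sub>1(3) t by (auto simp: W_def)
    then show ?thesis using inv closure_subset by auto
  next
    assume comm: "\<forall>s t::'t. s * t = t * s"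
    show ?thesis
    proof (rule ccontr)
      assume "act s (act t x) \<notin> closure U"
      then have "open (act t -` act s -` (- closure U))" "x \<in> act t -` act s -` (- closure U)"
        by (auto intro!: open_vimage_act simp del: vimage_Compl)
      then obtain W\<^sub>2 where W\<^sub>2: "open W\<^sub>2" "x \<in> W\<^sub>2"
        "\<And>q. act q x \<in> W\<^sub>2 \<Longrightarrow> iact q x \<in> act t -` act s -` (- closure U)"
        using aa_return[OF aa] by metis
      \<comment> \<open>Minimality replaces the missing inverse: \<open>s' * s\<close> nearly fixes
        \<open>x\<close>. By commutativity \<open>iact s'\<close> is \<open>act s\<close> after
        \<open>iact (s' * s)\<close>, an error that \<open>W\<^sub>2\<close> controls.\<close>
      obtain s' where s': "act s' (act s x) \<in> W\<^sub>2 \<inter> W"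
        using orbit_meets[of "W\<^sub>2 \<inter> W"] W\<^sub>2(1,2) W by blast
      have "act s' x = iact s (act s' (act s x))"
        using comm by (metis act_act iact_act)
      then have "act s' x \<in> W\<^sub>1" using W\<^sub>0(3)[of s] s s' by (auto simp: W_def)
      then have "iact s' (act t x) \<in> U" using W\<^sub>1(3) t by (auto simp: W_def)
      moreover have "iact s' (act t x) = act s (act t (iact (s' * s) x))"
      proof -
        have "act s' (act s (act t (iact (s' * s) x))) = act t (act (s' * s) (iact (s' * s) x))"
          using comm by (metis act_act)
        then show ?thesis by (simp add: iact_eq_iff)
      qed
      moreover have "act s (act t (iact (s' * s) x)) \<notin> closure U"
        using W\<^sub>2(3)[of "s' * s"] s' by (simp add: act_act)
      ultimately show False using closure_subset by auto
    qed
  qed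
  have "act s ` W \<subseteq> closure U" if "act s x \<in> W" for s
    by (rule image_subset_closure_if_orbit[OF continuous_act_right W(1) U_closure[OF that]])
  then show ?thesis using that W by blast
qed

section \<open>Local almost periodicity and distality\<close>

lemma aa_imp_lap_point:
  assumes "x \<in> aa_points act"
    and "(\<forall>t::'t. \<exists>s. s * t = 1 \<and> t * s = 1) \<or> (\<forall>s t::'t. s * t = t * s)"
  shows "lap_point (discrete_topology UNIV) act x"
  unfolding lap_point_def
proof (intro allI impI)
  fix U assume "x \<in> interior U"
  then obtain U' where U': "open U'" "x \<in> U'" "closure U' \<subseteq> interior U"
    using compact_t2_regular[OF compact_space open_interior] by blast
  obtain W where W: "open W" "x \<in> W" "\<And>s. act s x \<in> W \<Longrightarrow> act s ` W \<subseteq> closure U'"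
    using aa_forward_returns[OF assms(1) U'(1,2) assms(2)] by blast
  have "act t v \<in> U" if "act t x \<in> W" "v \<in> W" for t v
    using W(3)[OF that(1)] that(2) U'(3) interior_subset[of U] by blast
  then have "(\<lambda>(t, v). act t v) ` ({t. act t x \<in> W} \<times> W) \<subseteq> U" by auto
  then show "\<exists>V A. x \<in> interior V \<and> syndetic (discrete_topology UNIV) A \<and>
      (\<lambda>(t, v). act t v) ` (A \<times> V) \<subseteq> U"
    using W(1,2) syndetic_returns[of W x]
    by (intro exI[of _ W] exI[of _ "{t. act t x \<in> W}"] conjI) (auto simp: interior_open)
qed

lemma aa_imp_distal_point:
  assumes aa: "x \<in> aa_points act"
  shows "distal_point act x"
  unfolding distal_point_def
proof (intro ballI impI)
  fix y assume "proximal act x y"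
  then obtain D :: "('x set \<times> 'x set) set" and r t z where dir: "directed_on D r"
    and z: "((\<lambda>n. act (t n) x) \<longlongrightarrow> z) (tails D r)" "((\<lambda>n. act (t n) y) \<longlongrightarrow> z) (tails D r)"
    unfolding proximal_def by (elim exE conjE) (rule that)
  show "y = x"
  proof (rule eq_if_in_closure_nhds)
    fix U assume "open U" "x \<in> U"
    then obtain W where W: "open W" "x \<in> W" "\<And>s. act s x \<in> W \<Longrightarrow> iact s ` W \<subseteq> U"
      using aa_inverse_returns[OF aa] by blast
    \<comment> \<open>Minimality moves the common limit into \<open>W\<close>, so
      \<open>s * t n\<close> eventually brings both \<open>x\<close> and \<open>y\<close> into
      \<open>W\<close>.\<close>
    obtain s where s: "act s z \<in> W" using orbit_meets[OF W(1)] W(2) by blast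
    have "eventually (\<lambda>n. act (t n) x \<in> act s -` W \<and> act (t n) y \<in> act s -` W) (tails D r)"
      using s open_vimage_act[OF W(1)] z by (intro eventually_conj topological_tendstoD) auto
    then obtain n where "act (s * t n) x \<in> W" "act (s * t n) y \<in> W"
      using eventually_happens tails_neq_bot[OF dir] by (fastforce simp: act_act)
    then have "y \<in> U" using W(3) iact_act by (metis image_subset_iff)
    then show "y \<in> closure U" using closure_subset by blast
  qed
qed

end

theorem theorem2p5:
  fixes act :: "'t::topological_monoid_mult \<Rightarrow> 'x::t2_space \<Rightarrow> 'x" and x :: 'x
  assumes "compact (UNIV :: 'x set)"
    and "semiflow act" and "minimal_flow act" and "invertible_flow act"
    and "(\<forall>t::'t. \<exists>s. s * t = 1 \<and> t * s = 1) \<or> (\<forall>s t::'t. s * t = t * s)"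
    and "x \<in> aa_points act"
  shows "lap_point (discrete_topology UNIV) act x \<and> distal_point act x"
proof -
  interpret semiflow act by fact
  interpret compact_minimal_invertible_semiflow act
    using assms by unfold_locales
  show ?thesis using aa_imp_lap_point aa_imp_distal_point assms(5,6) by blast
qed

end
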